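(* Let $K$ be a field, let $\mathscr{P}=\mathbb{Z}^d$ or $\mathbb{R}^d$ (with the product order), let $\mathcal{A}$ be a class of pointwise finite-dimensional $\mathscr{P}$-modules over $K$ closed under isomorphisms and shifts (regarded as a full subcategory of the category of $\mathscr{P}$-modules), and let $\mathcal{F}$ be a functor from $\mathcal{A}$ to the category of finite-dimensional $K$-vector spaces. Then for any two modules $M,N\in\mathcal{A}$, $$d_E(\mathbf{rk}_{M^{\mathcal F}},\mathbf{rk}_{N^{\mathcal F}})\leq d_I(M,N).$$
   Context: A $\mathscr{P}$-module $M$ is a functor from the poset $\mathscr{P}$ to $K$-vector spaces, with spaces $M_x$ and structure maps $M_{yx}=M_{y,x}:M_x\to M_y$ for $x\leq y$; it is pointwise finite-dimensional if all $M_x$ are finite-dimensional. For $\varepsilon\in\mathscr{P}$ the shift $M[\varepsilon]$ is given by $(M[\varepsilon])_x=M_{x+\varepsilon}$, $(M[\varepsilon])_{yx}=M_{y+\varepsilon,x+\varepsilon}$, and $f[\varepsilon]_x=f_{x+\varepsilon}$ for a homomorphism $f$. For $\varepsilon\geq0$ in $\mathscr{P}$, $\mathsf{sh}^\varepsilon_M:M\to M[\varepsilon]$ is the homomorphism with components $M_{x+\varepsilon,x}$. For $M\in\mathcal{A}$, the $\mathscr{P}$-module $M^{\mathcal F}$ is defined by $M^{\mathcal F}_x:=\mathcal{F}(M[x])$ for $x\in\mathscr{P}$, and $M^{\mathcal F}_{y,x}:=\mathcal{F}(\mathsf{sh}^{y-x}_{M[x]}):\mathcal{F}(M[x])\to\mathcal{F}(M[y])$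 for $x\leq y$. The rank invariant of a $\mathscr{P}$-module $X$ is $\mathbf{rk}_X:\mathscr{P}\times\mathscr{P}\to\mathbb{N}\cup\{\infty\}$, with $\mathbf{rk}_X(x,y)=\operatorname{rank}(X_{yx})$ if $x\leq y$ and $\infty$ otherwise. Let $\mathbb{T}=\mathbb{Z}$ if $\mathscr{P}=\mathbb{Z}^d$ and $\mathbb{T}=\mathbb{R}$ if $\mathscr{P}=\mathbb{R}^d$; for $\varepsilon\in\mathbb{T}$ let $\overrightarrow{\varepsilon}=(\varepsilon,\ldots,\varepsilon)\in\mathscr{P}$. The infimum of the empty set is $\infty$. The erosion distance $d_E(F,G)$ between two rank invariants $F,G$ is the infimum of all $\varepsilon\in\mathbb{T}_{\geq0}$ such that $F(x-\overrightarrow{\varepsilon},y+\overrightarrow{\varepsilon})\leq G(x,y)$ and $G(x-\overrightarrow{\varepsilon},y+\overrightarrow{\varepsilon})\leq F(x,y)$ for all $x,y\in\mathscr{P}$. The interleaving distance $d_I(M,N)$ is the infimum of all $\varepsilon\in\mathbb{T}_{\geq0}$ for which there exist homomorphisms $\varphi:M\to N[\overrightarrow{\varepsilon}]$ and $\psi:N\to M[\overrightarrow{\varepsilon}]$ with $\psi[\overrightarrow{\varepsilon}]\circ\varphi=\mathsf{sh}_M^{2\overrightarrow{\varepsilon}}$ and $\varphi[\overrightarrow{\varepsilon}]\circ\psi=\mathsf{sh}_N^{2\overrightarrow{\varepsilon}}$. *)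

theory Defs
  imports
    "HOL-Analysis.Finite_Cartesian_Product"
    "HOL-Library.Extended_Real"
    "Jordan_Normal_Form.Missing_VectorSpace"
begin

text \<open>
  The class below has, up to isomorphism of ordered groups, exactly the two members
  \<^typ>\<open>int\<close> and \<^typ>\<open>real\<close>. For an instance \<open>'t\<close>, the poset of the theory is \<open>'t ^ 'd\<close>, whose
  library order is the product order.
\<close>

class int_or_real = linordered_ab_group_add +
  fixes real_val :: "'a \<Rightarrow> real"
  assumes real_val_add: "real_val (a + b) = real_val a + real_val b"
    and real_val_le_iff: "real_val a \<le> real_val b \<longleftrightarrow> a \<le> b"
    and range_real_val: "range real_val = \<int> \<or> range real_val = UNIV"

instantiation int :: int_or_real
begin

definition real_val_int :: "int \<Rightarrow> real" where
  "real_val_int = real_of_int"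

instance
  by standard (auto simp: real_val_int_def Ints_def)

end

instantiation real :: int_or_real
begin

definition real_val_real :: "real \<Rightarrow> real" where
  "real_val_real = (\<lambda>a. a)"

instance
  by standard (auto simp: real_val_real_def)

end


text \<open>
  Linear maps are extensional functions, so that equality of maps is equality on the carrier of
  the source, and composites are formed with \<^const>\<open>compose\<close>.
\<close>

definition linear_maps ::
  "('k, 'c) ring_scheme \<Rightarrow> ('k, 'v) module \<Rightarrow> ('k, 'w) module \<Rightarrow> ('v \<Rightarrow> 'w) set" where
  "linear_maps K V W = module_hom K V W \<inter> extensional (carrier V)"

definition map_rank ::
  "('k, 'c) ring_scheme \<Rightarrow> ('k, 'v) module \<Rightarrow> ('k, 'w) module \<Rightarrow> ('v \<Rightarrow> 'w) \<Rightarrow> enat" where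
  "map_rank K V W T =
     (let I = W\<lparr>carrier := T ` carrier V\<rparr>
      in if vectorspace.fin_dim K I then enat (vectorspace.dim K I) else \<infinity>)"


text \<open>
  \<open>pm_map M y x\<close> is the structure map from the space at \<open>x\<close> to the space at \<open>y\<close>; it is
  unconstrained unless \<open>x \<le> y\<close>. Records that differ only there are isomorphic modules.
\<close>

record ('p, 'k, 'v) pmodule =
  pm_space :: "'p \<Rightarrow> ('k, 'v) module"
  pm_map :: "'p \<Rightarrow> 'p \<Rightarrow> 'v \<Rightarrow> 'v"

definition is_pmodule :: "('k, 'c) ring_scheme \<Rightarrow> ('p::order, 'k, 'v) pmodule \<Rightarrow> bool" where
  "is_pmodule K M \<longleftrightarrow>
     (\<forall>x. vectorspace K (pm_space M x)) \<and>
     (\<forall>x y. x \<le> y \<longrightarrow> pm_map M y x \<in> linear_maps K (pm_space M x) (pm_space M y)) \<and>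
     (\<forall>x. pm_map M x x = (\<lambda>v\<in>carrier (pm_space M x). v)) \<and>
     (\<forall>x y z. x \<le> y \<longrightarrow> y \<le> z \<longrightarrow>
        pm_map M z x = compose (carrier (pm_space M x)) (pm_map M z y) (pm_map M y x))"

definition pointwise_fin_dim :: "('k, 'c) ring_scheme \<Rightarrow> ('p, 'k, 'v) pmodule \<Rightarrow> bool" where
  "pointwise_fin_dim K M \<longleftrightarrow> (\<forall>x. vectorspace.fin_dim K (pm_space M x))"

definition pm_hom ::
  "('k, 'c) ring_scheme \<Rightarrow> ('p::order, 'k, 'v) pmodule \<Rightarrow> ('p, 'k, 'w) pmodule
     \<Rightarrow> ('p \<Rightarrow> 'v \<Rightarrow> 'w) set" where
  "pm_hom K M N =
     {f. (\<forall>x. f x \<in> linear_maps K (pm_space M x) (pm_space N x)) \<and>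
         (\<forall>x y. x \<le> y \<longrightarrow>
            compose (carrier (pm_space M x)) (f y) (pm_map M y x) =
            compose (carrier (pm_space M x)) (pm_map N y x) (f x))}"

definition pm_id :: "('p, 'k, 'v) pmodule \<Rightarrow> 'p \<Rightarrow> 'v \<Rightarrow> 'v" where
  "pm_id M = (\<lambda>x. \<lambda>v\<in>carrier (pm_space M x). v)"

text \<open>The first argument of \<open>pm_comp\<close> is the source of the map that is applied first.\<close>

definition pm_comp ::
  "('p, 'k, 'u) pmodule \<Rightarrow> ('p \<Rightarrow> 'v \<Rightarrow> 'w) \<Rightarrow> ('p \<Rightarrow> 'u \<Rightarrow> 'v) \<Rightarrow> 'p \<Rightarrow> 'u \<Rightarrow> 'w" where
  "pm_comp M g f = (\<lambda>x. compose (carrier (pm_space M x)) (g x) (f x))"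

definition pm_isomorphic ::
  "('k, 'c) ring_scheme \<Rightarrow> ('p::order, 'k, 'v) pmodule \<Rightarrow> ('p, 'k, 'w) pmodule \<Rightarrow> bool" where
  "pm_isomorphic K M N \<longleftrightarrow>
     (\<exists>f\<in>pm_hom K M N. \<exists>g\<in>pm_hom K N M. pm_comp M g f = pm_id M \<and> pm_comp N f g = pm_id N)"

definition pm_shift ::
  "('p::plus, 'k, 'v) pmodule \<Rightarrow> 'p \<Rightarrow> ('p, 'k, 'v) pmodule" where
  "pm_shift M e =
     \<lparr>pm_space = (\<lambda>x. pm_space M (x + e)), pm_map = (\<lambda>y x. pm_map M (y + e) (x + e))\<rparr>"

definition hom_shift :: "('p::plus \<Rightarrow> 'v \<Rightarrow> 'w) \<Rightarrow> 'p \<Rightarrow> 'p \<Rightarrow> 'v \<Rightarrow> 'w" where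
  "hom_shift f e = (\<lambda>x. f (x + e))"

definition sh :: "('p::plus, 'k, 'v) pmodule \<Rightarrow> 'p \<Rightarrow> 'p \<Rightarrow> 'v \<Rightarrow> 'v" where
  "sh M e = (\<lambda>x. pm_map M (x + e) x)"


definition iso_closed :: "('k, 'c) ring_scheme \<Rightarrow> ('p::order, 'k, 'v) pmodule set \<Rightarrow> bool" where
  "iso_closed K A \<longleftrightarrow> (\<forall>M\<in>A. \<forall>N. is_pmodule K N \<longrightarrow> pm_isomorphic K M N \<longrightarrow> N \<in> A)"

definition shift_closed :: "('p::plus, 'k, 'v) pmodule set \<Rightarrow> bool" where
  "shift_closed A \<longleftrightarrow> (\<forall>M\<in>A. \<forall>e. pm_shift M e \<in> A)"

text \<open>
  A functor to finite-dimensional vector spaces, on the full subcategory with object class \<open>A\<close>.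
  A family of functions does not determine its source and target, so the morphism part \<open>FM\<close>
  takes them as its first two arguments.
\<close>

definition is_vect_functor ::
  "('k, 'c) ring_scheme \<Rightarrow> ('p::order, 'k, 'v) pmodule set
     \<Rightarrow> (('p, 'k, 'v) pmodule \<Rightarrow> ('k, 'w) module)
     \<Rightarrow> (('p, 'k, 'v) pmodule \<Rightarrow> ('p, 'k, 'v) pmodule \<Rightarrow> ('p \<Rightarrow> 'v \<Rightarrow> 'v) \<Rightarrow> 'w \<Rightarrow> 'w) \<Rightarrow> bool" where
  "is_vect_functor K A FO FM \<longleftrightarrow>
     (\<forall>M\<in>A. vectorspace K (FO M) \<and> vectorspace.fin_dim K (FO M)) \<and>
     (\<forall>M\<in>A. \<forall>N\<in>A. \<forall>f\<in>pm_hom K M N. FM M N f \<in> linear_maps K (FO M) (FO N)) \<and>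
     (\<forall>M\<in>A. FM M M (pm_id M) = (\<lambda>v\<in>carrier (FO M). v)) \<and>
     (\<forall>L\<in>A. \<forall>M\<in>A. \<forall>N\<in>A. \<forall>f\<in>pm_hom K L M. \<forall>g\<in>pm_hom K M N.
        FM L N (pm_comp L g f) = compose (carrier (FO L)) (FM M N g) (FM L M f))"

text \<open>
  The target of \<open>sh (pm_shift M x) (y - x)\<close> is \<open>pm_shift (pm_shift M x) (y - x)\<close>, which equals
  \<open>pm_shift M y\<close>.
\<close>

definition induced_pmodule ::
  "(('p::ab_group_add, 'k, 'v) pmodule \<Rightarrow> ('k, 'w) module)
     \<Rightarrow> (('p, 'k, 'v) pmodule \<Rightarrow> ('p, 'k, 'v) pmodule \<Rightarrow> ('p \<Rightarrow> 'v \<Rightarrow> 'v) \<Rightarrow> 'w \<Rightarrow> 'w)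
     \<Rightarrow> ('p, 'k, 'v) pmodule \<Rightarrow> ('p, 'k, 'w) pmodule" where
  "induced_pmodule FO FM M =
     \<lparr>pm_space = (\<lambda>x. FO (pm_shift M x)),
      pm_map = (\<lambda>y x. FM (pm_shift M x) (pm_shift M y) (sh (pm_shift M x) (y - x)))\<rparr>"


definition rank_invariant ::
  "('k, 'c) ring_scheme \<Rightarrow> ('p::order, 'k, 'v) pmodule \<Rightarrow> 'p \<Rightarrow> 'p \<Rightarrow> enat" where
  "rank_invariant K X x y =
     (if x \<le> y then map_rank K (pm_space X x) (pm_space X y) (pm_map X y x) else \<infinity>)"

definition erosion_distance ::
  "('t::int_or_real ^ 'd::finite \<Rightarrow> 't ^ 'd \<Rightarrow> enat) \<Rightarrow> ('t ^ 'd \<Rightarrow> 't ^ 'd \<Rightarrow> enat) \<Rightarrow> ereal" where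
  "erosion_distance F G =
     (INF e\<in>{e. 0 \<le> e \<and>
        (\<forall>x y. F (x - vec e) (y + vec e) \<le> G x y \<and> G (x - vec e) (y + vec e) \<le> F x y)}.
        ereal (real_val e))"

definition interleaved ::
  "('k, 'c) ring_scheme \<Rightarrow> 't::int_or_real
     \<Rightarrow> ('t ^ 'd::finite, 'k, 'v) pmodule \<Rightarrow> ('t ^ 'd, 'k, 'w) pmodule \<Rightarrow> bool" where
  "interleaved K e M N \<longleftrightarrow>
     (\<exists>\<phi>\<in>pm_hom K M (pm_shift N (vec e)). \<exists>\<psi>\<in>pm_hom K N (pm_shift M (vec e)).
        pm_comp M (hom_shift \<psi> (vec e)) \<phi> = sh M (vec e + vec e) \<and>
        pm_comp N (hom_shift \<phi> (vec e)) \<psi> = sh N (vec e + vec e))"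

definition interleaving_distance ::
  "('k, 'c) ring_scheme
     \<Rightarrow> ('t::int_or_real ^ 'd::finite, 'k, 'v) pmodule \<Rightarrow> ('t ^ 'd, 'k, 'w) pmodule \<Rightarrow> ereal" where
  "interleaving_distance K M N = (INF e\<in>{e. 0 \<le> e \<and> interleaved K e M N}. ereal (real_val e))"

end

theory Submission
  imports Defs
begin

text \<open>
  Let \<open>\<phi>\<close> and \<open>\<psi>\<close> be an interleaving of \<open>M\<close> and \<open>N\<close> with shift vector \<open>a\<close>. For \<open>x \<le> y\<close>, the shift
  morphism from \<open>M[x - a]\<close> to \<open>M[y + a]\<close> factors as
  \<open>M[x - a] \<rightarrow> N[x] \<rightarrow> N[y] \<rightarrow> M[y + a]\<close>, where the outer maps are \<open>\<phi>[x - a]\<close> and \<open>\<psi>[y]\<close> and the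
  middle one is the shift morphism of \<open>N\<close>: naturality of \<open>\<psi>\<close> moves the shift of \<open>N\<close> past \<open>\<psi>\<close>, and
  then the interleaving identity applies. A functor preserves this factorization, and the rank of
  a composite is at most the rank of its middle factor. Hence every interleaving parameter is also
  an erosion parameter.
\<close>

text \<open>The lemmas on shifts are stated over an arbitrary ordered abelian group; these instances
  make them applicable to \<open>'t ^ 'd\<close>.\<close>

instance vec :: (ordered_ab_semigroup_add, finite) ordered_ab_semigroup_add
  by standard (simp add: less_eq_vec_def add_left_mono)

instance vec :: (ordered_ab_group_add, finite) ordered_ab_group_add ..

section \<open>Dimensions of images and ranks of linear maps\<close>

lemma (in vectorspace) dim_mono:
  assumes X: "subspace K X V" and Y: "subspace K Y V" and "X \<subseteq> Y"
    and fX: "vectorspace.fin_dim K (vs X)" and fY: "vectorspace.fin_dim K (vs Y)"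
  shows "vectorspace.dim K (vs X) \<le> vectorspace.dim K (vs Y)"
proof -
  interpret X: vectorspace K "vs X" by (rule subspace_is_vs[OF X])
  interpret Y: vectorspace K "vs Y" by (rule subspace_is_vs[OF Y])
  obtain B where B: "finite B" "X.basis B"
    using X.finite_basis_exists[OF fX] by blast
  then have BX: "B \<subseteq> X" "\<not> X.lin_dep B" by (auto simp: X.basis_def)
  \<comment> \<open>Linear dependence in a subspace agrees with dependence in the ambient space.
    Hence the basis \<open>B\<close> of \<open>X\<close> stays independent in \<open>Y\<close>,
    which bounds its size by \<open>Y.dim\<close>.\<close>
  then have "\<not> Y.lin_dep B"
    using span_li_not_depend(2)[of B X] span_li_not_depend(2)[of B Y] X Y \<open>X \<subseteq> Y\<close> by auto
  then have "card B \<le> Y.dim"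
    using Y.li_le_dim(2)[OF fY] BX \<open>X \<subseteq> Y\<close> by auto
  then show ?thesis using X.dim_basis[OF B] by simp
qed

lemma linear_map_image:
  assumes V: "vectorspace K V" "vectorspace.fin_dim K V" and W: "vectorspace K W"
    and T: "T \<in> module_hom K V W"
  shows "subspace K (T ` carrier V) W"
    and "vectorspace.fin_dim K (W\<lparr>carrier := T ` carrier V\<rparr>)"
    and "vectorspace.dim K (W\<lparr>carrier := T ` carrier V\<rparr>) \<le> vectorspace.dim K V"
proof -
  interpret V: vectorspace K V by fact
  interpret W: vectorspace K W by fact
  interpret T: linear_map K V W T
    using V W T by (simp add: linear_map_def mod_hom_def mod_hom_axioms_def vectorspace_def)
  show sub: "subspace K (T ` carrier V) W"
    using T.imT_is_subspace by (simp add: T.im_def)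
  let ?I = "W\<lparr>carrier := T ` carrier V\<rparr>"
  have I: "vectorspace K ?I" by (rule W.subspace_is_vs[OF sub])
  \<comment> \<open>Corestricted to its image, \<open>T\<close> is surjective, so finite
    dimensionality passes from \<open>V\<close> to the image. The dimension bound is
    rank-nullity.\<close>
  have "T \<in> module_hom K V ?I"
    using T by (auto simp: module_hom_def)
  then interpret TI: linear_map K V ?I T
    using V I by (simp add: linear_map_def mod_hom_def mod_hom_axioms_def vectorspace_def)
  show "vectorspace.fin_dim K ?I"
    using TI.surj_fin_dim[OF V(2)] by simp
  show "vectorspace.dim K ?I \<le> V.dim"
    using T.rank_nullity[OF V(2)] by (simp add: T.im_def)
qed

text \<open>A finite-dimensional source excludes the infinite branch of \<open>map_rank\<close>, so
  ranks can be compared as natural numbers.\<close>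

lemma map_rank_eq_dim:
  assumes "vectorspace K V" "vectorspace.fin_dim K V" "vectorspace K W" "T \<in> module_hom K V W"
  shows "map_rank K V W T = enat (vectorspace.dim K (W\<lparr>carrier := T ` carrier V\<rparr>))"
  using linear_map_image(2)[OF assms] by (simp add: map_rank_def Let_def)

lemma (in module) module_hom_compose:
  assumes "f \<in> module_hom R M N" "g \<in> module_hom R N P"
  shows "compose (carrier M) g f \<in> module_hom R M P"
  using assms by (auto simp: module_hom_def compose_def Pi_iff)

text \<open>The image of \<open>T\<close> is the image under \<open>C\<close> of a subspace of the
  image of \<open>B\<close>. Applying \<open>C\<close> cannot raise the dimension, and neither can
  passing to a subspace.\<close>

lemma map_rank_factor_le:
  assumes U: "vectorspace K U" "vectorspace.fin_dim K U"
    and V: "vectorspace K V" "vectorspace.fin_dim K V"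
    and W: "vectorspace K W" and X: "vectorspace K X"
    and A: "A \<in> module_hom K U V" and B: "B \<in> module_hom K V W" and C: "C \<in> module_hom K W X"
    and T: "T \<in> module_hom K U X" "\<And>u. u \<in> carrier U \<Longrightarrow> T u = C (B (A u))"
  shows "map_rank K U X T \<le> map_rank K V W B"
proof -
  interpret W: vectorspace K W by fact
  let ?BA = "\<lambda>u. B (A u)"
  let ?I = "W\<lparr>carrier := ?BA ` carrier U\<rparr>"
  have BA: "?BA \<in> module_hom K U W"
    using A B by (auto simp: module_hom_def Pi_iff)
  note im_BA = linear_map_image[OF U W BA]
  have vs_I: "vectorspace K ?I"
    by (rule W.subspace_is_vs[OF im_BA(1)])
  have "C \<in> module_hom K ?I X"
    using C module_hom_closed[OF BA] by (auto simp: module_hom_def Pi_iff)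
  from linear_map_image(3)[OF vs_I im_BA(2) X this]
  have "vectorspace.dim K (X\<lparr>carrier := C ` ?BA ` carrier U\<rparr>) \<le> vectorspace.dim K ?I"
    by simp
  also have "\<dots> \<le> vectorspace.dim K (W\<lparr>carrier := B ` carrier V\<rparr>)"
    using linear_map_image[OF V W B] im_BA module_hom_closed[OF A] by (intro W.dim_mono) auto
  also have "C ` ?BA ` carrier U = T ` carrier U"
    using T(2) by (auto simp: image_iff)
  finally show ?thesis
    by (simp add: map_rank_eq_dim[OF U X T(1)] map_rank_eq_dim[OF V W B])
qed

section \<open>Shifts and morphisms of modules over an ordered group\<close>

lemma is_pmodule_map_linear:
  assumes "is_pmodule K M" "x \<le> y"
  shows "pm_map M y x \<in> linear_maps K (pm_space M x) (pm_space M y)"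
  using assms unfolding is_pmodule_def by blast

lemma is_pmodule_map_comp:
  assumes "is_pmodule K M" "x \<le> y" "y \<le> z" "v \<in> carrier (pm_space M x)"
  shows "pm_map M z y (pm_map M y x v) = pm_map M z x v"
proof -
  have "pm_map M z x = compose (carrier (pm_space M x)) (pm_map M z y) (pm_map M y x)"
    using assms(1-3) unfolding is_pmodule_def by blast
  then show ?thesis using assms(4) by (simp add: compose_eq)
qed

lemma pm_shift_simps [simp]:
  "pm_space (pm_shift M e) x = pm_space M (x + e)"
  "pm_map (pm_shift M e) y x = pm_map M (y + e) (x + e)"
  by (simp_all add: pm_shift_def)

text \<open>This is an equality of records, not only an isomorphism, so iterated shifts can be
  replaced by single ones in the source and target arguments of \<open>FM\<close>.\<close>

lemma pm_shift_pm_shift: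
  fixes M :: "('p::ab_semigroup_add, 'k, 'v) pmodule"
  shows "pm_shift (pm_shift M a) b = pm_shift M (a + b)"
  by (simp add: pm_shift_def add.commute add.left_commute)

lemma is_pmodule_pm_shift:
  fixes M :: "('p::ordered_ab_group_add, 'k, 'v) pmodule"
  assumes "is_pmodule K M"
  shows "is_pmodule K (pm_shift M e)"
  using assms by (simp add: is_pmodule_def)

lemma hom_shift_in_pm_hom:
  fixes M :: "('p::ordered_ab_group_add, 'k, 'v) pmodule"
  assumes "f \<in> pm_hom K M N"
  shows "hom_shift f e \<in> pm_hom K (pm_shift M e) (pm_shift N e)"
  using assms by (simp add: pm_hom_def hom_shift_def)

lemma sh_in_pm_hom:
  fixes M :: "('p::ordered_ab_group_add, 'k, 'v) pmodule"
  assumes "is_pmodule K M" "0 \<le> e"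
  shows "sh M e \<in> pm_hom K M (pm_shift M e)"
  unfolding pm_hom_def
proof (intro CollectI conjI allI impI)
  show "sh M e x \<in> linear_maps K (pm_space M x) (pm_space (pm_shift M e) x)" for x
    using assms is_pmodule_map_linear[of K M x "x + e"] by (simp add: sh_def)
  fix x y :: 'p assume xy: "x \<le> y"
  have le: "x \<le> x + e" "y \<le> y + e" "x + e \<le> y + e" using xy assms(2) by simp_all
  \<comment> \<open>Both ways around the naturality square give the structure map from
    \<open>x\<close> to \<open>y + e\<close>.\<close>
  have "pm_map M (y + e) y (pm_map M y x v) = pm_map M (y + e) (x + e) (pm_map M (x + e) x v)"
    if "v \<in> carrier (pm_space M x)" for v
    using is_pmodule_map_comp[OF assms(1) xy le(2) that]
      is_pmodule_map_comp[OF assms(1) le(1,3) that] by simp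
  then show "compose (carrier (pm_space M x)) (sh M e y) (pm_map M y x) =
      compose (carrier (pm_space M x)) (pm_map (pm_shift M e) y x) (sh M e x)"
    by (auto simp: compose_def sh_def restrict_def)
qed

lemma pm_hom_naturality:
  assumes "f \<in> pm_hom K M N" "x \<le> y" "v \<in> carrier (pm_space M x)"
  shows "f y (pm_map M y x v) = pm_map N y x (f x v)"
proof -
  have "compose (carrier (pm_space M x)) (f y) (pm_map M y x) v =
      compose (carrier (pm_space M x)) (pm_map N y x) (f x) v"
    using assms by (simp add: pm_hom_def)
  then show ?thesis using assms(3) by (simp add: compose_eq)
qed

lemma pm_comp_in_pm_hom:
  assumes f: "f \<in> pm_hom K L M" and g: "g \<in> pm_hom K M N" and L: "is_pmodule K L"
  shows "pm_comp L g f \<in> pm_hom K L N"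
  unfolding pm_hom_def
proof (intro CollectI conjI allI impI)
  fix x
  have f': "f x \<in> module_hom K (pm_space L x) (pm_space M x)"
    and g': "g x \<in> module_hom K (pm_space M x) (pm_space N x)"
    using f g by (auto simp: pm_hom_def linear_maps_def)
  have "module K (pm_space L x)"
    using L by (simp add: is_pmodule_def vectorspace_def)
  then show "pm_comp L g f x \<in> linear_maps K (pm_space L x) (pm_space N x)"
    using module.module_hom_compose[OF _ f' g']
    by (simp add: pm_comp_def linear_maps_def)
  fix y assume xy: "x \<le> y"
  \<comment> \<open>The composite is restricted to the carrier at \<open>y\<close>, so unfolding it
    there requires the structure map of \<open>L\<close> to land in that carrier.\<close>
  then have L_map: "pm_map L y x \<in> carrier (pm_space L x) \<rightarrow> carrier (pm_space L y)"
    using is_pmodule_map_linear[OF L xy] by (auto simp: linear_maps_def dest: module_hom_closed)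
  have "g y (f y (pm_map L y x v)) = pm_map N y x (g x (f x v))"
    if "v \<in> carrier (pm_space L x)" for v
    using pm_hom_naturality[OF f xy that] pm_hom_naturality[OF g xy] that module_hom_closed[OF f']
    by auto
  then show "compose (carrier (pm_space L x)) (pm_comp L g f y) (pm_map L y x) =
      compose (carrier (pm_space L x)) (pm_map N y x) (pm_comp L g f x)"
    using L_map by (auto simp: pm_comp_def compose_def Pi_iff restrict_def fun_eq_iff)
qed

section \<open>From interleavings to inequalities of rank invariants\<close>

lemma interleaving_factorization:
  fixes M :: "('p::ordered_ab_group_add, 'k, 'v) pmodule" and N :: "('p, 'k, 'w) pmodule"
  assumes M: "is_pmodule K M" and a: "0 \<le> a" and xy: "x \<le> y"
    and \<phi>: "\<phi> \<in> pm_hom K M (pm_shift N a)" and \<psi>: "\<psi> \<in> pm_hom K N (pm_shift M a)"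
    and comp: "pm_comp M (hom_shift \<psi> a) \<phi> = sh M (a + a)"
  defines "L \<equiv> pm_shift M (x - a)"
  shows "pm_comp L (hom_shift \<psi> y) (pm_comp L (sh (pm_shift N x) (y - x)) (hom_shift \<phi> (x - a)))
           = sh L ((y + a) - (x - a))"
proof (intro ext)
  have "x - a \<le> x" "y \<le> y + a" using a by simp_all
  then have le: "x - a \<le> y + a" using xy by (meson order_trans)
  fix z v
  show "pm_comp L (hom_shift \<psi> y)
      (pm_comp L (sh (pm_shift N x) (y - x)) (hom_shift \<phi> (x - a))) z v = sh L ((y + a) - (x - a)) z v"
  proof (cases "v \<in> carrier (pm_space L z)")
    \<comment> \<open>Outside the carrier both sides are \<open>undefined\<close>: the left by
      \<open>compose\<close>, the right because structure maps are extensional.\<close>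
    case False
    have "z \<le> z + ((y + a) - (x - a))"
      using le by simp
    then have "sh L ((y + a) - (x - a)) z \<in> extensional (carrier (pm_space L z))"
      using is_pmodule_map_linear[OF is_pmodule_pm_shift[OF M]]
      unfolding L_def linear_maps_def sh_def by blast
    then show ?thesis
      using False by (simp add: pm_comp_def compose_def extensional_def)
  next
    case True
    \<comment> \<open>The space of \<open>M[x - a]\<close> at \<open>z\<close> is that of
      \<open>M\<close> at \<open>w\<close>. Since \<open>w + a = z + x\<close>, the map
      \<open>\<phi> w\<close> lands in the space of \<open>N[x]\<close> at \<open>z\<close>.\<close>
    define w where "w = z + (x - a)"
    have v: "v \<in> carrier (pm_space M w)"
      using True by (simp add: L_def w_def)
    have "\<phi> w \<in> module_hom K (pm_space M w) (pm_space N (w + a))"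
      using \<phi> by (auto simp: pm_hom_def linear_maps_def)
    then have \<phi>v: "\<phi> w v \<in> carrier (pm_space N (w + a))"
      using v by (auto dest: module_hom_closed)
    have w: "w + a = z + x" by (simp add: w_def)
    have w_le: "w \<le> w + a + a"
      using a by (simp add: add.assoc)
    have le: "w + a \<le> z + y" "w + a + a \<le> z + y + a"
      using xy by (simp_all add: w)
    have "pm_comp L (hom_shift \<psi> y)
        (pm_comp L (sh (pm_shift N x) (y - x)) (hom_shift \<phi> (x - a))) z v
        = \<psi> (z + y) (pm_map N (z + y) (w + a) (\<phi> w v))"
      using True unfolding w
      by (simp add: pm_comp_def compose_eq hom_shift_def sh_def L_def add.assoc flip: w_def)
    also have "\<dots> = pm_map M (z + y + a) (w + a + a) (\<psi> (w + a) (\<phi> w v))"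
      using pm_hom_naturality[OF \<psi> le(1) \<phi>v] by simp
    \<comment> \<open>The interleaving identity \<open>comp\<close>, evaluated at
      \<open>w\<close>.\<close>
    also have "\<psi> (w + a) (\<phi> w v) = pm_map M (w + a + a) w v"
      using fun_cong[OF fun_cong[OF comp, of w], of v] v
      by (simp add: pm_comp_def compose_eq hom_shift_def sh_def add.assoc)
    also have "pm_map M (z + y + a) (w + a + a) \<dots> = pm_map M (z + y + a) w v"
      using M w_le le(2) v by (rule is_pmodule_map_comp)
    also have "\<dots> = sh L ((y + a) - (x - a)) z v"
      by (simp add: sh_def L_def w_def add.assoc)
    finally show ?thesis .
  qed
qed

lemma rank_invariant_interleaved_le:
  fixes M N :: "('p::ordered_ab_group_add, 'k, 'v) pmodule"
  assumes pm: "\<And>X. X \<in> A \<Longrightarrow> is_pmodule K X" and A: "shift_closed A"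
    and F: "is_vect_functor K A FO FM"
    and M: "M \<in> A" and N: "N \<in> A" and a: "0 \<le> a"
    and \<phi>: "\<phi> \<in> pm_hom K M (pm_shift N a)" and \<psi>: "\<psi> \<in> pm_hom K N (pm_shift M a)"
    and comp: "pm_comp M (hom_shift \<psi> a) \<phi> = sh M (a + a)"
  shows "rank_invariant K (induced_pmodule FO FM M) (x - a) (y + a)
           \<le> rank_invariant K (induced_pmodule FO FM N) x y"
proof (cases "x \<le> y")
  \<comment> \<open>Here the right-hand rank is infinite by convention.\<close>
  case False
  then show ?thesis by (simp add: rank_invariant_def)
next
  case xy: True
  have "x - a \<le> x" "y \<le> y + a" using a by simp_all
  then have xy': "x - a \<le> y + a" using xy by (meson order_trans)
  let ?L = "pm_shift M (x - a)" and ?R = "pm_shift M (y + a)"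
  let ?Nx = "pm_shift N x" and ?Ny = "pm_shift N y"
  let ?s = "sh ?Nx (y - x)" and ?t = "sh ?L ((y + a) - (x - a))"
  let ?\<phi> = "hom_shift \<phi> (x - a)" and ?\<psi> = "hom_shift \<psi> y"
  have inA: "?L \<in> A" "?R \<in> A" "?Nx \<in> A" "?Ny \<in> A"
    using A M N by (simp_all add: shift_closed_def)
  have f: "?\<phi> \<in> pm_hom K ?L ?Nx"
    using hom_shift_in_pm_hom[OF \<phi>, of "x - a"] by (simp add: pm_shift_pm_shift)
  have g: "?s \<in> pm_hom K ?Nx ?Ny"
    using sh_in_pm_hom[OF pm[OF inA(3)], of "y - x"] xy by (simp add: pm_shift_pm_shift)
  have h: "?\<psi> \<in> pm_hom K ?Ny ?R"
    using hom_shift_in_pm_hom[OF \<psi>, of y] by (simp add: pm_shift_pm_shift add.commute)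
  have t: "?t \<in> pm_hom K ?L ?R"
    using sh_in_pm_hom[OF pm[OF inA(1)], of "(y + a) - (x - a)"] xy'
    by (simp add: pm_shift_pm_shift)
  have gf: "pm_comp ?L ?s ?\<phi> \<in> pm_hom K ?L ?Ny"
    by (rule pm_comp_in_pm_hom[OF f g pm[OF inA(1)]])
  have vs: "vectorspace K (FO X)" "vectorspace.fin_dim K (FO X)" if "X \<in> A" for X
    using F that by (simp_all add: is_vect_functor_def)
  have hom: "FM X Y u \<in> module_hom K (FO X) (FO Y)"
    if "X \<in> A" "Y \<in> A" "u \<in> pm_hom K X Y" for X Y u
    using F that unfolding is_vect_functor_def linear_maps_def by blast
  have FM_comp: "FM X Z (pm_comp X u' u) v = FM Y Z u' (FM X Y u v)"
    if "X \<in> A" "Y \<in> A" "Z \<in> A" "u \<in> pm_hom K X Y" "u' \<in> pm_hom K Y Z" "v \<in> carrier (FO X)"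
    for X Y Z u u' v
  proof -
    have "FM X Z (pm_comp X u' u) = compose (carrier (FO X)) (FM Y Z u') (FM X Y u)"
      using F that(1-5) unfolding is_vect_functor_def by blast
    then show ?thesis using that(6) by (simp add: compose_eq)
  qed
  have "FM ?L ?R ?t v = FM ?Ny ?R ?\<psi> (FM ?Nx ?Ny ?s (FM ?L ?Nx ?\<phi> v))"
    if "v \<in> carrier (FO ?L)" for v
    using FM_comp[OF inA(1,4,2) gf h that] FM_comp[OF inA(1,3,4) f g that]
      interleaving_factorization[OF pm[OF M] a xy \<phi> \<psi> comp]
    by simp
  \<comment> \<open>The two maps are the structure maps of the induced modules, of \<open>M\<close>
    from \<open>x - a\<close> to \<open>y + a\<close> and of \<open>N\<close> from \<open>x\<close>
    to \<open>y\<close>.\<close>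
  then have "map_rank K (FO ?L) (FO ?R) (FM ?L ?R ?t) \<le> map_rank K (FO ?Nx) (FO ?Ny) (FM ?Nx ?Ny ?s)"
    using inA f g h t by (intro map_rank_factor_le[OF vs vs vs(1) vs(1) hom hom hom hom])
  then show ?thesis
    using xy xy' by (simp add: rank_invariant_def induced_pmodule_def)
qed

theorem theorem28:
  fixes K :: "('k, 'c) ring_scheme"
    and A :: "('t::int_or_real ^ 'd::finite, 'k, 'v) pmodule set"
    and FO :: "('t ^ 'd, 'k, 'v) pmodule \<Rightarrow> ('k, 'w) module"
    and FM :: "('t ^ 'd, 'k, 'v) pmodule \<Rightarrow> ('t ^ 'd, 'k, 'v) pmodule
                 \<Rightarrow> ('t ^ 'd \<Rightarrow> 'v \<Rightarrow> 'v) \<Rightarrow> 'w \<Rightarrow> 'w"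
    and M N :: "('t ^ 'd, 'k, 'v) pmodule"
  assumes "field K"
    and "\<And>X. X \<in> A \<Longrightarrow> is_pmodule K X \<and> pointwise_fin_dim K X"
    and "iso_closed K A"
    and "shift_closed A"
    and "is_vect_functor K A FO FM"
    and "M \<in> A" and "N \<in> A"
  shows "erosion_distance (rank_invariant K (induced_pmodule FO FM M))
                          (rank_invariant K (induced_pmodule FO FM N))
         \<le> interleaving_distance K M N"
  unfolding erosion_distance_def interleaving_distance_def
\<comment> \<open>Enlarging the index set can only lower an infimum. This includes the case without
  interleavings, where the right side is infinite.\<close>
proof (rule INF_superset_mono, rule subsetI)
  fix e :: 't
  assume "e \<in> {e. 0 \<le> e \<and> interleaved K e M N}"
  then obtain \<phi> \<psi> where e: "0 \<le> e"
    and \<phi>: "\<phi> \<in> pm_hom K M (pm_shift N (vec e))" and \<psi>: "\<psi> \<in> pm_hom K N (pm_shift M (vec e))"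
    and comp: "pm_comp M (hom_shift \<psi> (vec e)) \<phi> = sh M (vec e + vec e)"
      "pm_comp N (hom_shift \<phi> (vec e)) \<psi> = sh N (vec e + vec e)"
    unfolding interleaved_def by blast
  have pm: "is_pmodule K X" if "X \<in> A" for X using assms(2) that by blast
  have vec: "(0 :: 't ^ 'd) \<le> vec e" using e by (simp add: less_eq_vec_def)
  show "e \<in> {e. 0 \<le> e \<and> (\<forall>x y.
      rank_invariant K (induced_pmodule FO FM M) (x - vec e) (y + vec e)
        \<le> rank_invariant K (induced_pmodule FO FM N) x y \<and>
      rank_invariant K (induced_pmodule FO FM N) (x - vec e) (y + vec e)
        \<le> rank_invariant K (induced_pmodule FO FM M) x y)}"
    \<comment> \<open>Exchanging \<open>M\<close> with \<open>N\<close> and \<open>\<phi>\<close>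
      with \<open>\<psi>\<close> yields the second inequality from the second interleaving
      identity.\<close>
    using e rank_invariant_interleaved_le[OF pm assms(4,5,6,7) vec \<phi> \<psi> comp(1)]
      rank_invariant_interleaved_le[OF pm assms(4,5,7,6) vec \<psi> \<phi> comp(2)]
    by blast
qed (rule order_refl)

end
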